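(* Let $a\in\mathbb{R}$ with $|a|<1$. For $k\in\mathbb{N}$ and $x\in\mathbb{R}$ let $c_k(x)=\sqrt2\cos(2k\pi x)$, $s_k(x)=\sqrt2\sin(2k\pi x)$, and define $$\widehat c_k(x)=\sqrt{1-a^2}\sum_{n=0}^\infty a^n c_k(2^nx),\qquad \widehat s_k(x)=\sqrt{1-a^2}\sum_{n=0}^\infty a^n s_k(2^nx).$$ For $i\in\mathbb{N}$ define $$\widetilde c_i=\begin{cases}\widehat c_i & i \text{ odd},\\ \dfrac{\widehat c_i-a\widehat c_{i/2}}{\sqrt{1-a^2}}=\sqrt{1-a^2}\,\widehat c_i-a\,c_{i/2} & i \text{ even},\end{cases}\qquad \widetilde s_i=\begin{cases}\widehat s_i & i \text{ odd},\\ \dfrac{\widehat s_i-a\widehat s_{i/2}}{\sqrt{1-a^2}}=\sqrt{1-a^2}\,\widehat s_i-a\,s_{i/2} & i \text{ even}.\end{cases}$$ Then $\{1,\widetilde c_k,\widetilde s_k:k\in\mathbb{N}\}$ is a complete orthonormal basis of $L^2([0,1])$ (and the two displayed expressions for the even case agree).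
   Context: $L^2([0,1])$ has inner product $\langle f,h\rangle=\int_0^1 f(x)h(x)\,dx$. The functions $\widehat c_k,\widehat s_k$ equal $\sqrt{1-a^2}\,M_{a,2}^{-1}c_k$ and $\sqrt{1-a^2}\,M_{a,2}^{-1}s_k$, where $(M_{a,2}f)(x)=f(x)-af(2x)$. *)

theory Defs
  imports "HOL-Analysis.Analysis"
begin

definition ck :: "nat \<Rightarrow> real \<Rightarrow> real" where
  "ck k x = sqrt 2 * cos (2 * real k * pi * x)"

definition sk :: "nat \<Rightarrow> real \<Rightarrow> real" where
  "sk k x = sqrt 2 * sin (2 * real k * pi * x)"

definition chat :: "real \<Rightarrow> nat \<Rightarrow> real \<Rightarrow> real" where
  "chat a k x = sqrt (1 - a^2) * (\<Sum>n. a ^ n * ck k (2 ^ n * x))"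

definition shat :: "real \<Rightarrow> nat \<Rightarrow> real \<Rightarrow> real" where
  "shat a k x = sqrt (1 - a^2) * (\<Sum>n. a ^ n * sk k (2 ^ n * x))"

definition ctil :: "real \<Rightarrow> nat \<Rightarrow> real \<Rightarrow> real" where
  "ctil a i x = (if odd i then chat a i x
                 else (chat a i x - a * chat a (i div 2) x) / sqrt (1 - a^2))"

definition stil :: "real \<Rightarrow> nat \<Rightarrow> real \<Rightarrow> real" where
  "stil a i x = (if odd i then shat a i x
                 else (shat a i x - a * shat a (i div 2) x) / sqrt (1 - a^2))"

definition L2_01 :: "(real \<Rightarrow> real) set" where
  "L2_01 = {f. f \<in> borel_measurable (lebesgue_on {0..1}) \<and>
               integrable (lebesgue_on {0..1}) (\<lambda>x. (f x)^2)}"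

definition inner01 :: "(real \<Rightarrow> real) \<Rightarrow> (real \<Rightarrow> real) \<Rightarrow> real" where
  "inner01 f g = integral\<^sup>L (lebesgue_on {0..1}) (\<lambda>x. f x * g x)"

definition complete_orthonormal_basis_L2 :: "'i set \<Rightarrow> ('i \<Rightarrow> real \<Rightarrow> real) \<Rightarrow> bool" where
  "complete_orthonormal_basis_L2 I e \<longleftrightarrow>
     (\<forall>i\<in>I. e i \<in> L2_01) \<and>
     (\<forall>i\<in>I. \<forall>j\<in>I. inner01 (e i) (e j) = (if i = j then 1 else 0)) \<and>
     (\<forall>h\<in>L2_01. \<forall>\<epsilon>>0. \<exists>F c. finite F \<and> F \<subseteq> I \<and>
        inner01 (\<lambda>x. h x - (\<Sum>i\<in>F. c i * e i x)) (\<lambda>x. h x - (\<Sum>i\<in>F. c i * e i x)) < \<epsilon>)"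

datatype tidx = One | Cos nat | Sin nat

definition tidx_set :: "tidx set" where
  "tidx_set = {One} \<union> {Cos k | k. k \<ge> 1} \<union> {Sin k | k. k \<ge> 1}"

fun tbasis :: "real \<Rightarrow> tidx \<Rightarrow> real \<Rightarrow> real" where
  "tbasis a One = (\<lambda>x. 1)"
| "tbasis a (Cos k) = ctil a k"
| "tbasis a (Sin k) = stil a k"

end

theory Submission
  imports Defs
begin

text \<open>
  The functions \<open>c\<^sub>k(2\<^sup>nx)\<close> are \<open>c\<close> with index \<open>2\<^sup>nk\<close>, so the hat functions whose indices have
  different odd parts are orthogonal, and for a common odd part \<open>m\<close> the Gram matrix of the hat functions
  with indices \<open>2\<^sup>pm\<close> and \<open>2\<^sup>qm\<close> is \<open>a\<close> to the power \<open>\<bar>p - q\<bar>\<close>. The tilde functions arise from it by a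
  Gram--Schmidt step that only involves the preceding index, whence orthonormality. For
  completeness, a hat function is a finite combination of tilde functions, and \<open>c\<^sub>k\<close> is a combination
  of the hat functions with indices \<open>k\<close> and \<open>2k\<close>; so every trigonometric polynomial is a finite
  combination of the proposed basis, and trigonometric polynomials are dense in \<open>L\<^sup>2\<close> by the
  Stone--Weierstrass theorem on the circle.
\<close>

section \<open>The trigonometric system\<close>

lemma continuous_L2_01:
  assumes "continuous_on {0..1} f"
  shows "f \<in> L2_01"
  unfolding L2_01_def
  using assms by (auto intro!: continuous_imp_integrable_real continuous_intros
      continuous_imp_measurable_on_sets_lebesgue)

text \<open>The antiderivative takes equal values at 0 and 1; it divides by \<open>m\<close>, so
  frequency zero is split off. Frequencies are integers because products of trigonometric functions
  produce index differences.\<close>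

lemma integral_cos_multiple:
  "integral\<^sup>L (lebesgue_on {0..1}) (\<lambda>x. cos (2 * pi * of_int m * x)) = (if m = 0 then 1 else 0)"
proof (cases "m = 0")
  case False
  define F where "F = (\<lambda>x. sin (2 * pi * of_int m * x) / (2 * pi * of_int m))"
  have "((\<lambda>x. cos (2 * pi * of_int m * x)) has_integral (F 1 - F 0)) {0..1}"
  proof (rule fundamental_theorem_of_calculus)
    fix x :: real
    show "(F has_vector_derivative cos (2 * pi * of_int m * x)) (at x within {0..1})"
      using False unfolding F_def has_real_derivative_iff_has_vector_derivative[symmetric]
      by (auto intro!: derivative_eq_intros)
  qed simp
  moreover have "F 1 = 0" "F 0 = 0"
    using sin_int_2pin[of m] by (simp_all add: F_def)
  ultimately show ?thesis using False
    by (subst lebesgue_integral_eq_integral)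
      (auto intro!: continuous_imp_integrable_real continuous_intros)
qed (simp add: measure_restrict_space)

lemma integral_sin_multiple:
  "integral\<^sup>L (lebesgue_on {0..1}) (\<lambda>x. sin (2 * pi * of_int m * x)) = 0"
proof (cases "m = 0")
  case False
  define F where "F = (\<lambda>x. - cos (2 * pi * of_int m * x) / (2 * pi * of_int m))"
  have "((\<lambda>x. sin (2 * pi * of_int m * x)) has_integral (F 1 - F 0)) {0..1}"
  proof (rule fundamental_theorem_of_calculus)
    fix x :: real
    show "(F has_vector_derivative sin (2 * pi * of_int m * x)) (at x within {0..1})"
      using False unfolding F_def has_real_derivative_iff_has_vector_derivative[symmetric]
      by (auto intro!: derivative_eq_intros)
  qed simp
  moreover have "F 1 = F 0"
    using cos_int_2pin[of m] by (simp add: F_def)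
  ultimately show ?thesis
    by (subst lebesgue_integral_eq_integral)
      (auto intro!: continuous_imp_integrable_real continuous_intros)
qed simp

text \<open>Product-to-sum formula; the two factors \<open>sqrt 2\<close> absorb its usual
  1/2.\<close>

lemma ck_mult_ck:
  "ck i x * ck j x = cos (2 * pi * of_int (int i - int j) * x) + cos (2 * pi * of_int (int i + int j) * x)"
  by (simp add: ck_def cos_diff cos_add algebra_simps)

lemma sk_mult_sk:
  "sk i x * sk j x = cos (2 * pi * of_int (int i - int j) * x) - cos (2 * pi * of_int (int i + int j) * x)"
  by (simp add: sk_def cos_diff cos_add algebra_simps)

lemma ck_mult_sk:
  "ck i x * sk j x = sin (2 * pi * of_int (int i + int j) * x) - sin (2 * pi * of_int (int i - int j) * x)"
  by (simp add: sk_def ck_def sin_diff sin_add algebra_simps)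

lemma integrable_trig_multiple [simp]:
  "integrable (lebesgue_on {0..1}) (\<lambda>x. cos (2 * pi * c * x))"
  "integrable (lebesgue_on {0..1}) (\<lambda>x. sin (2 * pi * c * x))"
  by (auto intro!: continuous_imp_integrable_real continuous_intros)

text \<open>Positive indices keep the sum frequency nonzero, so only the difference frequency can
  contribute, and it does so exactly when \<open>i = j\<close>.\<close>

lemma inner01_ck_ck:
  "0 < i \<Longrightarrow> 0 < j \<Longrightarrow> inner01 (ck i) (ck j) = (if i = j then 1 else 0)"
  unfolding inner01_def ck_mult_ck
  by (subst Bochner_Integration.integral_add) (auto simp only: integral_cos_multiple integrable_trig_multiple, auto)

lemma inner01_sk_sk:
  "0 < i \<Longrightarrow> 0 < j \<Longrightarrow> inner01 (sk i) (sk j) = (if i = j then 1 else 0)"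
  unfolding inner01_def sk_mult_sk
  by (subst Bochner_Integration.integral_diff) (auto simp only: integral_cos_multiple integrable_trig_multiple, auto)

lemma inner01_ck_sk: "inner01 (ck i) (sk j) = 0"
  unfolding inner01_def ck_mult_sk
  by (subst Bochner_Integration.integral_diff) (auto simp only: integral_sin_multiple integrable_trig_multiple)

lemma inner01_ck_1: "0 < i \<Longrightarrow> inner01 (ck i) (\<lambda>x. 1) = 0"
  using integral_cos_multiple[of "int i"]
  by (simp add: inner01_def ck_def mult_ac)

lemma inner01_sk_1: "inner01 (sk i) (\<lambda>x. 1) = 0"
  using integral_sin_multiple[of "int i"]
  by (simp add: inner01_def sk_def mult_ac)

lemma inner01_commute: "inner01 f g = inner01 g f"
  by (simp add: inner01_def mult.commute)

lemma inner01_left_linear: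
  assumes "continuous_on {0..1} f" "continuous_on {0..1} g" "continuous_on {0..1} h"
  shows "inner01 (\<lambda>x. r * f x + t * g x) h = r * inner01 f h + t * inner01 g h"
proof -
  have "(\<lambda>x. (r * f x + t * g x) * h x) = (\<lambda>x. r * (f x * h x) + t * (g x * h x))"
    by (simp add: algebra_simps)
  moreover have "integrable (lebesgue_on {0..1}) (\<lambda>x. r * (f x * h x))"
    "integrable (lebesgue_on {0..1}) (\<lambda>x. t * (g x * h x))"
    using assms by (auto intro!: continuous_imp_integrable_real continuous_intros)
  ultimately show ?thesis
    by (simp add: inner01_def)
qed

lemma inner01_right_linear:
  assumes "continuous_on {0..1} f" "continuous_on {0..1} g" "continuous_on {0..1} h"
  shows "inner01 h (\<lambda>x. r * f x + t * g x) = r * inner01 h f + t * inner01 h g"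
  using inner01_left_linear[OF assms] by (simp add: inner01_commute)

section \<open>Hat and tilde transforms of a bounded family\<close>

text \<open>Dilation of the argument by \<open>2 ^ n\<close> becomes multiplication of the index,
  which is the same thing for \<open>ck\<close> and \<open>sk\<close>. One argument then serves both
  families.\<close>

definition hat :: "real \<Rightarrow> (nat \<Rightarrow> real \<Rightarrow> real) \<Rightarrow> nat \<Rightarrow> real \<Rightarrow> real" where
  "hat a u k x = sqrt (1 - a\<^sup>2) * (\<Sum>n. a ^ n * u (2 ^ n * k) x)"

definition til :: "real \<Rightarrow> (nat \<Rightarrow> real \<Rightarrow> real) \<Rightarrow> nat \<Rightarrow> real \<Rightarrow> real" where
  "til a u k x = (if odd k then hat a u k x
     else (hat a u k x - a * hat a u (k div 2) x) / sqrt (1 - a\<^sup>2))"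

lemma chat_eq_hat: "chat a = hat a ck"
  by (intro ext) (simp add: chat_def hat_def ck_def mult_ac)

lemma shat_eq_hat: "shat a = hat a sk"
  by (intro ext) (simp add: shat_def hat_def sk_def mult_ac)

lemma ctil_eq_til: "ctil a = til a ck"
  by (intro ext) (simp add: ctil_def til_def chat_eq_hat)

lemma stil_eq_til: "stil a = til a sk"
  by (intro ext) (simp add: stil_def til_def shat_eq_hat)

text \<open>Continuity and a uniform bound give convergence, continuity and termwise integration of
  the hat series; orthogonality enters only later.\<close>

locale bounded_family =
  fixes u :: "nat \<Rightarrow> real \<Rightarrow> real" and C :: real
  assumes continuous: "continuous_on {0..1} (u k)"
    and bounded: "\<bar>u k x\<bar> \<le> C"

interpretation ck: bounded_family ck "sqrt 2"
  by standard (auto simp: ck_def abs_mult intro!: continuous_intros)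

interpretation sk: bounded_family sk "sqrt 2"
  by standard (auto simp: sk_def abs_mult intro!: continuous_intros)

context bounded_family
begin

lemma norm_term_le: "norm (a ^ n * u k x) \<le> C * \<bar>a\<bar> ^ n"
  using mult_right_mono[OF bounded, of "\<bar>a\<bar> ^ n" k x] by (simp add: abs_mult power_abs mult.commute)

context
  fixes a :: real
  assumes a: "\<bar>a\<bar> < 1"
begin

lemma summable_terms: "summable (\<lambda>n. a ^ n * u (f n) x)"
  using norm_term_le by (rule summable_comparison_test'[where N = 0, rotated])
    (use a in \<open>auto intro!: summable_mult summable_geometric\<close>)

text \<open>The partial sums converge uniformly by the Weierstrass M-test with majorant
  \<open>C * \<bar>a\<bar> ^ n\<close>.\<close>

lemma continuous_on_hat: "continuous_on {0..1} (hat a u k)"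
proof -
  have "continuous_on {0..1} (\<lambda>x. \<Sum>n. a ^ n * u (2 ^ n * k) x)"
  proof (rule uniform_limit_theorem)
    show "uniform_limit {0..1} (\<lambda>n x. \<Sum>i<n. a ^ i * u (2 ^ i * k) x)
        (\<lambda>x. \<Sum>i. a ^ i * u (2 ^ i * k) x) sequentially"
      by (rule Weierstrass_m_test[OF norm_term_le])
        (use a in \<open>auto intro!: summable_mult summable_geometric\<close>)
  qed (auto intro!: always_eventually continuous_intros continuous)
  then show ?thesis
    unfolding hat_def by (intro continuous_intros)
qed

text \<open>Splitting off the term \<open>n = 0\<close> leaves \<open>a\<close> times the series for
  index \<open>2 * k\<close>. This expresses that the hat transform inverts \<open>M_{a,2}\<close>
  up to the normalising factor.\<close>

lemma hat_unfold: "hat a u k x = sqrt (1 - a\<^sup>2) * u k x + a * hat a u (2 * k) x"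
proof -
  have "(\<Sum>n. a ^ n * u (2 ^ n * k) x) = u k x + (\<Sum>n. a ^ Suc n * u (2 ^ Suc n * k) x)"
    by (subst suminf_split_head[OF summable_terms]) simp
  also have "(\<Sum>n. a ^ Suc n * u (2 ^ Suc n * k) x) = a * (\<Sum>n. a ^ n * u (2 ^ n * (2 * k)) x)"
    by (subst suminf_mult[OF summable_terms, symmetric]) (simp add: mult_ac)
  finally show ?thesis
    by (simp add: hat_def algebra_simps)
qed

lemma continuous_on_til: "continuous_on {0..1} (til a u k)"
proof -
  have "sqrt (1 - a\<^sup>2) \<noteq> 0"
    using a by (simp add: abs_square_eq_1)
  then have "continuous_on {0..1} (\<lambda>x. (hat a u k x - a * hat a u (k div 2) x) / sqrt (1 - a\<^sup>2))"
    by (intro continuous_intros continuous_on_hat) auto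
  then show ?thesis
    using continuous_on_hat unfolding til_def by (cases "odd k") auto
qed

text \<open>Substituting \<open>hat_unfold\<close> at \<open>k div 2\<close> turns the numerator
  into \<open>(1 - a\<^sup>2) * hat a u k x - a * sqrt (1 - a\<^sup>2) * u (k div 2)
  x\<close>.\<close>

lemma even_til_alternative:
  assumes "even k"
  shows "(hat a u k x - a * hat a u (k div 2) x) / sqrt (1 - a\<^sup>2)
    = sqrt (1 - a\<^sup>2) * hat a u k x - a * u (k div 2) x"
proof -
  have "sqrt (1 - a\<^sup>2) > 0" "sqrt (1 - a\<^sup>2) * sqrt (1 - a\<^sup>2) = 1 - a\<^sup>2"
    using a by (simp_all add: abs_square_less_1 abs_square_le_1)
  then show ?thesis
    using hat_unfold[of "k div 2" x] assms
    by (simp add: field_simps) (simp add: power2_eq_square flip: distrib_left)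
qed

text \<open>Sum and integral may be exchanged because the terms are dominated by the summable
  constants \<open>C * B * \<bar>a\<bar> ^ n\<close>, where \<open>B\<close> bounds \<open>g\<close>
  on the compact interval.\<close>

lemma inner01_hat_left:
  assumes "continuous_on {0..1} g"
  shows "inner01 (hat a u k) g = sqrt (1 - a\<^sup>2) * (\<Sum>n. a ^ n * inner01 (u (2 ^ n * k)) g)"
proof -
  let ?M = "lebesgue_on {0..1::real}"
  let ?f = "\<lambda>n x. a ^ n * (u (2 ^ n * k) x * g x)"
  obtain B where B: "\<And>x. x \<in> {0..1} \<Longrightarrow> norm (g x) \<le> B"
    using compact_imp_bounded[OF compact_continuous_image[OF assms]] unfolding bounded_iff by blast
  \<comment> \<open>Multiplying the two bounds needs \<open>C * \<bar>a\<bar> ^ n\<close> to be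
    nonnegative, which holds because it dominates a norm.\<close>
  have le: "norm (?f n x) \<le> C * B * \<bar>a\<bar> ^ n" if "x \<in> {0..1}" for n x
    using mult_mono[OF norm_term_le[of a n "2 ^ n * k" x] B[OF that]]
      order_trans[OF norm_ge_zero norm_term_le[of a n "2 ^ n * k" x]]
    by (simp add: abs_mult mult_ac)
  have int: "integrable ?M (?f n)" for n
    by (auto intro!: continuous_imp_integrable_real continuous_intros continuous assms)
  have geo: "summable (\<lambda>n. C * B * \<bar>a\<bar> ^ n)"
    using a by (auto intro!: summable_mult summable_geometric)
  have "(\<integral>x. (\<Sum>n. ?f n x) \<partial>?M) = (\<Sum>n. integral\<^sup>L ?M (?f n))"
  proof (rule integral_suminf[OF int])
    show "AE x in ?M. summable (\<lambda>n. norm (?f n x))"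
      by (rule AE_I2) (rule summable_comparison_test'[OF geo, where N = 0], use le in auto)
    have "(\<integral>x. norm (?f n x) \<partial>?M) \<le> (\<integral>x. C * B * \<bar>a\<bar> ^ n \<partial>?M)" for n
      by (rule integral_mono[OF integrable_norm[OF int]]) (use le in auto)
    then show "summable (\<lambda>n. \<integral>x. norm (?f n x) \<partial>?M)"
      by (intro summable_comparison_test'[OF geo, where N = 0]) (auto simp: measure_restrict_space)
  qed
  moreover have "(\<lambda>x. hat a u k x * g x) = (\<lambda>x. sqrt (1 - a\<^sup>2) * (\<Sum>n. ?f n x))"
    by (rule ext) (simp add: hat_def suminf_mult2[OF summable_terms] mult.assoc)
  ultimately show ?thesis
    by (simp add: inner01_def)
qed

text \<open>Termwise integration makes hat functions of positive index orthogonal to 1, and a tilde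
  function combines at most two of these; halving a positive even index keeps it positive.\<close>

lemma inner01_til_1:
  assumes "\<And>k. 0 < k \<Longrightarrow> inner01 (u k) (\<lambda>x. 1) = 0" "0 < k"
  shows "inner01 (til a u k) (\<lambda>x. 1) = 0"
proof -
  have 0: "inner01 (hat a u k) (\<lambda>x. 1) = 0" if "0 < k" for k
    using that by (simp add: inner01_hat_left assms(1))
  have "til a u k = (\<lambda>x. 1 / sqrt (1 - a\<^sup>2) * hat a u k x + - a / sqrt (1 - a\<^sup>2) * hat a u (k div 2) x)" if "even k"
    using that by (auto simp: til_def fun_eq_iff diff_divide_distrib)
  then have "inner01 (til a u k) (\<lambda>x. 1) = 1 / sqrt (1 - a\<^sup>2) * inner01 (hat a u k) (\<lambda>x. 1)
      + - a / sqrt (1 - a\<^sup>2) * inner01 (hat a u (k div 2)) (\<lambda>x. 1)" if "even k"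
    using that by (simp only: inner01_left_linear continuous_on_hat continuous_on_const)
  moreover have "til a u k = hat a u k" if "odd k"
    using that by (auto simp: til_def fun_eq_iff)
  moreover have "0 < k div 2" if "even k"
    using that assms(2) by auto
  ultimately show ?thesis
    using 0 assms(2) by (cases "odd k") simp_all
qed

end

end

text \<open>The exponent is recovered as the multiplicity of 2; cancelling the power leaves the odd
  part.\<close>

lemma two_power_times_odd_eq_iff:
  fixes m m' :: nat
  assumes "odd m" "odd m'"
  shows "2 ^ p * m = 2 ^ q * m' \<longleftrightarrow> p = q \<and> m = m'"
proof
  assume eq: "2 ^ p * m = 2 ^ q * m'"
  have "multiplicity 2 (2 ^ p * m) = p" "multiplicity 2 (2 ^ q * m') = q"
    using assms by (auto intro!: multiplicity_decomposeI)
  then show "p = q \<and> m = m'"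
    using eq by auto
qed simp

section \<open>Orthonormality\<close>

text \<open>
  The value \<open>\<delta> = 1\<close> covers a pair of equal orthonormal families, \<open>\<delta> = 0\<close> the cosines against the sines.
\<close>

locale biorthogonal_families =
  U: bounded_family u C + V: bounded_family v D for u C v D +
  fixes \<delta> :: real
  assumes biorthogonal: "0 < i \<Longrightarrow> 0 < j \<Longrightarrow> inner01 (u i) (v j) = (if i = j then \<delta> else 0)"
begin

context
  fixes a :: real
  assumes a: "\<bar>a\<bar> < 1"
begin

text \<open>In the series for the hat function only the term with \<open>n + p = q\<close> can meet
  the index \<open>2 ^ q * m'\<close>, so at most one term survives.\<close>

lemma inner01_hat_plain:
  assumes "odd m" "odd m'"
  shows "inner01 (hat a u (2 ^ p * m)) (v (2 ^ q * m'))
    = (if m = m' \<and> p \<le> q then sqrt (1 - a\<^sup>2) * a ^ (q - p) * \<delta> else 0)"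
proof -
  have pos: "0 < m" "0 < m'"
    using assms by (auto intro: odd_pos)
  have "inner01 (u (2 ^ n * (2 ^ p * m))) (v (2 ^ q * m')) = (if n + p = q \<and> m = m' then \<delta> else 0)" for n
    using biorthogonal[of "2 ^ (n + p) * m" "2 ^ q * m'"] pos
    unfolding two_power_times_odd_eq_iff[OF assms] by (simp add: power_add mult.assoc)
  \<comment> \<open>For \<open>p > q\<close> the truncated \<open>q - p\<close> is 0, but the inner
    condition \<open>p \<le> q\<close> makes that term vanish.\<close>
  then have eq: "a ^ n * inner01 (u (2 ^ n * (2 ^ p * m))) (v (2 ^ q * m'))
      = (if n = q - p then (if m = m' \<and> p \<le> q then a ^ (q - p) * \<delta> else 0) else 0)" for n
    by auto
  show ?thesis
    unfolding U.inner01_hat_left[OF a V.continuous] eq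
    using sums_unique[OF sums_single[of "q - p" "\<lambda>_. if m = m' \<and> p \<le> q then a ^ (q - p) * \<delta> else 0"]] by simp
qed

text \<open>Expanding the second hat function gives a geometric series in \<open>a\<^sup>2\<close>;
  its sum \<open>1 / (1 - a\<^sup>2)\<close> cancels the two square-root factors. Since
  \<open>p \<le> q\<close>, every term survives.\<close>

lemma inner01_hat_hat_le:
  assumes "odd m" "odd m'" "p \<le> q"
  shows "inner01 (hat a u (2 ^ p * m)) (hat a v (2 ^ q * m')) = (if m = m' then a ^ (q - p) * \<delta> else 0)"
proof -
  have pos: "1 - a\<^sup>2 > 0" "norm (a\<^sup>2) < 1"
    using a by (simp_all add: abs_square_less_1)
  have exponent: "a ^ (n + q - p) = a ^ n * a ^ (q - p)" for n
    by (simp only: diff_add_assoc[OF assms(3)] power_add)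
  have "a ^ n * inner01 (v (2 ^ n * (2 ^ q * m'))) (hat a u (2 ^ p * m))
      = (if m = m' then sqrt (1 - a\<^sup>2) * a ^ (q - p) * \<delta> else 0) * (a\<^sup>2) ^ n" for n
    using inner01_hat_plain[OF assms(1,2), of p "n + q"] assms(3)
    unfolding inner01_commute[of "v _"]
    by (simp add: exponent power_add mult_ac power2_eq_square power_mult_distrib)
  moreover have sqrt_sqrt: "sqrt (1 - a\<^sup>2) * (sqrt (1 - a\<^sup>2) * c) = (1 - a\<^sup>2) * c" for c
    using pos by (simp flip: mult.assoc)
  ultimately show ?thesis
    using pos by (subst inner01_commute)
      (simp add: V.inner01_hat_left[OF a U.continuous_on_hat[OF a]] suminf_mult suminf_geometric mult.assoc sqrt_sqrt)
qed

end

text \<open>Lets the Gram computation for ordered exponents be reused with the families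
  exchanged.\<close>

lemma swap: "biorthogonal_families v D u C \<delta>"
  using biorthogonal by unfold_locales (auto simp: inner01_commute[of "v _"])

context
  fixes a :: real
  assumes a: "\<bar>a\<bar> < 1"
begin

text \<open>The exponent is the distance of \<open>p\<close> and \<open>q\<close>, written without
  leaving the natural numbers.\<close>

lemma inner01_hat_hat:
  assumes "odd m" "odd m'"
  shows "inner01 (hat a u (2 ^ p * m)) (hat a v (2 ^ q * m'))
    = (if m = m' then a ^ (max p q - min p q) * \<delta> else 0)"
proof (cases "p \<le> q")
  case True
  then show ?thesis using inner01_hat_hat_le[OF a assms True] by (simp add: max_def min_def)
next
  case False
  then show ?thesis
    using biorthogonal_families.inner01_hat_hat_le[OF swap a assms(2,1), of q p]
    by (subst inner01_commute) (simp add: max_def min_def)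
qed

text \<open>Different odd parts give only vanishing hat products. For a common odd part and
  \<open>r < q\<close>, the tilde function of exponent \<open>q\<close> is orthogonal to the hat
  function of exponent \<open>r\<close>, as \<open>a ^ (q - r) - a * a ^ (q - 1 - r) = 0\<close>.
  Unequal exponents therefore give 0.\<close>

lemma inner01_til_til:
  assumes "0 < i" "0 < j"
  shows "inner01 (til a u i) (til a v j) = (if i = j then \<delta> else 0)"
proof -
  define s where "s = sqrt (1 - a\<^sup>2)"
  have s: "s > 0" "s * s = 1 - a\<^sup>2"
    using a by (simp_all add: s_def abs_square_less_1 abs_square_le_1)
  obtain p m where i: "i = 2 ^ p * m" "odd m"
    using multiplicity_decompose'[of i 2] assms(1) by (metis less_irrefl odd_one)
  obtain q m' where j: "j = 2 ^ q * m'" "odd m'"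
    using multiplicity_decompose'[of j 2] assms(2) by (metis less_irrefl odd_one)
  have til_0: "til a w (2 ^ 0 * m) = hat a w (2 ^ 0 * m)" if "odd m" for w m
    using that by (simp add: til_def fun_eq_iff)
  have til_Suc: "til a w (2 ^ Suc p * m)
      = (\<lambda>x. 1 / s * hat a w (2 ^ Suc p * m) x + - a / s * hat a w (2 ^ p * m) x)" for w p m
    by (simp add: til_def fun_eq_iff diff_divide_distrib s_def)
  note expand = inner01_left_linear inner01_right_linear continuous_on_add continuous_on_mult
    continuous_on_const U.continuous_on_hat[OF a] V.continuous_on_hat[OF a] inner01_hat_hat[OF i(2) j(2)]
  have eq_iff: "i = j \<longleftrightarrow> p = q \<and> m = m'"
    using two_power_times_odd_eq_iff i j by simp
  show ?thesis
  proof (cases "m = m'")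
    case False
    then show ?thesis
      using eq_iff unfolding i(1) j(1)
      by (cases p; cases q) (simp_all only: til_0 i(2) j(2) til_Suc expand, simp_all)
  next
    case True
    note expand_til = til_0[OF i(2)] til_0[OF j(2)] til_Suc expand
    have rhs: "(if i = j then \<delta> else 0) = (if p = q then \<delta> else 0)"
      using eq_iff True by simp
    \<comment> \<open>Writing the larger of two unequal positive exponents as
      \<open>Suc (Suc (r + d))\<close> makes the order of both exponents and their predecessors
      explicit, so that \<open>max\<close> and \<open>min\<close> simplify away.\<close>
    consider "p = 0" "q = 0" | r where "p = 0" "q = Suc r" | r where "p = Suc r" "q = 0"
      | r where "p = Suc r" "q = Suc r" | r d where "p = Suc r" "q = Suc (Suc (r + d))"
      | r d where "p = Suc (Suc (r + d))" "q = Suc r"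
      by (metis less_imp_Suc_add linorder_neqE_nat not0_implies_Suc add_Suc)
    then show ?thesis
    proof cases
      case 1
      show ?thesis unfolding rhs unfolding i(1) j(1) 1 by (simp only: expand_til) (simp add: True)
    next
      case 2
      show ?thesis unfolding rhs unfolding i(1) j(1) 2 by (simp only: expand_til) (simp add: True)
    next
      case 3
      show ?thesis unfolding rhs unfolding i(1) j(1) 3 by (simp only: expand_til) (simp add: True)
    next
      case 4
      \<comment> \<open>The four products add up to
        \<open>(1 - 2 * a\<^sup>2 + a\<^sup>2) * \<delta>\<close>, and \<open>s * s\<close> cancels
        the first factor.\<close>
      show ?thesis unfolding rhs unfolding i(1) j(1) 4 using s
        by (simp only: expand_til)
          (simp add: True field_simps, simp add: power2_eq_square add.commute flip: distrib_left)
    next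
      case 5
      show ?thesis unfolding rhs unfolding i(1) j(1) 5 using s
        by (simp only: expand_til) (simp add: True field_simps)
    next
      case 6
      show ?thesis unfolding rhs unfolding i(1) j(1) 6 using s
        by (simp only: expand_til) (simp add: True field_simps)
    qed
  qed
qed

end
end

section \<open>Density of trigonometric polynomials\<close>

text \<open>Coefficients sit at the generators, so no scaling rule is needed, and the generators are
  multiples of \<open>ck\<close> and \<open>sk\<close>; constants arise from frequency zero.\<close>

inductive trigpoly :: "(real \<Rightarrow> real) \<Rightarrow> bool" where
  cos: "trigpoly (\<lambda>x. r * cos (2 * pi * real k * x))"
| sin: "trigpoly (\<lambda>x. r * sin (2 * pi * real k * x))"
| add: "trigpoly f \<Longrightarrow> trigpoly g \<Longrightarrow> trigpoly (\<lambda>x. f x + g x)"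

lemma trigpoly_const: "trigpoly (\<lambda>x. r)"
  using trigpoly.cos[of r 0] by simp

text \<open>Product-to-sum formulas produce negative frequencies, which evenness of the cosine
  removes; for the sine the sign moves into the coefficient.\<close>

lemma trigpoly_cos_int: "trigpoly (\<lambda>x. r * cos (2 * pi * of_int m * x))"
proof (cases "m \<ge> 0")
  case True
  then show ?thesis using trigpoly.cos[of r "nat m"] by simp
next
  case False
  then have "cos (2 * pi * real (nat (- m)) * x) = cos (2 * pi * of_int m * x)" for x
    using cos_minus[of "2 * pi * of_int m * x"] by simp
  then show ?thesis using trigpoly.cos[of r "nat (- m)"] by simp
qed

lemma trigpoly_sin_int: "trigpoly (\<lambda>x. r * sin (2 * pi * of_int m * x))"
proof (cases "m \<ge> 0")
  case True
  then show ?thesis using trigpoly.sin[of r "nat m"] by simp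
next
  case False
  then have "- sin (2 * pi * real (nat (- m)) * x) = sin (2 * pi * of_int m * x)" for x
    using sin_minus[of "2 * pi * of_int m * x"] by simp
  then have "(- r) * sin (2 * pi * real (nat (- m)) * x) = r * sin (2 * pi * of_int m * x)" for x
    by (metis mult_minus_left mult_minus_right)
  then show ?thesis using trigpoly.sin[of "- r" "nat (- m)"] by simp
qed

lemma trigpoly_mult_cos:
  assumes "trigpoly f"
  shows "trigpoly (\<lambda>x. r * cos (2 * pi * real j * x) * f x)"
  using assms
proof induction
  case (cos t k)
  have "(\<lambda>x. r * cos (2 * pi * real j * x) * (t * cos (2 * pi * real k * x)))
      = (\<lambda>x. (r * t / 2) * cos (2 * pi * of_int (int j - int k) * x)
           + (r * t / 2) * cos (2 * pi * of_int (int j + int k) * x))"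
    by (rule ext) (simp add: ring_distribs cos_diff cos_add)
  then show ?case by (simp only: trigpoly.add trigpoly_cos_int)
next
  case (sin t k)
  have "(\<lambda>x. r * cos (2 * pi * real j * x) * (t * sin (2 * pi * real k * x)))
      = (\<lambda>x. (r * t / 2) * sin (2 * pi * of_int (int k - int j) * x)
           + (r * t / 2) * sin (2 * pi * of_int (int j + int k) * x))"
    by (rule ext) (simp add: ring_distribs sin_diff sin_add)
  then show ?case by (simp only: trigpoly.add trigpoly_sin_int)
next
  case (add f g)
  then show ?case using trigpoly.add by (simp add: distrib_left)
qed

lemma trigpoly_mult_sin:
  assumes "trigpoly f"
  shows "trigpoly (\<lambda>x. r * sin (2 * pi * real j * x) * f x)"
  using assms
proof induction
  case (cos t k)
  have "(\<lambda>x. r * sin (2 * pi * real j * x) * (t * cos (2 * pi * real k * x)))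
      = (\<lambda>x. (r * t / 2) * sin (2 * pi * of_int (int j - int k) * x)
           + (r * t / 2) * sin (2 * pi * of_int (int j + int k) * x))"
    by (rule ext) (simp add: ring_distribs sin_diff sin_add)
  then show ?case by (simp only: trigpoly.add trigpoly_sin_int)
next
  case (sin t k)
  have "(\<lambda>x. r * sin (2 * pi * real j * x) * (t * sin (2 * pi * real k * x)))
      = (\<lambda>x. (r * t / 2) * cos (2 * pi * of_int (int j - int k) * x)
           + (- r * t / 2) * cos (2 * pi * of_int (int j + int k) * x))"
    by (rule ext) (simp add: ring_distribs cos_diff cos_add)
  then show ?case by (simp only: trigpoly.add trigpoly_cos_int)
next
  case (add f g)
  then show ?case using trigpoly.add by (simp add: distrib_left)
qed

text \<open>Closure under products makes the class an algebra, so polynomials on the circle pull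
  back into it.\<close>

lemma trigpoly_mult:
  assumes "trigpoly f" "trigpoly g"
  shows "trigpoly (\<lambda>x. f x * g x)"
  using assms(1)
proof induction
  case (add f h)
  then show ?case using trigpoly.add by (simp add: distrib_right)
qed (use trigpoly_mult_cos trigpoly_mult_sin assms(2) in auto)

text \<open>A real-linear functional restricted to the circle is a combination of \<open>cos\<close>
  and \<open>sin\<close> of frequency one; the other generation rules are the algebra
  operations.\<close>

lemma trigpoly_of_real_polynomial_function:
  fixes p :: "complex \<Rightarrow> real"
  assumes "real_polynomial_function p"
  shows "trigpoly (\<lambda>x. p (cis (2 * pi * x)))"
  using assms
proof induction
  case (linear f)
  interpret bounded_linear f by fact
  have "f (cis t) = f 1 * cos t + f \<i> * sin t" for t
  proof -
    have "cis t = cos t *\<^sub>R 1 + sin t *\<^sub>R \<i>"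
      by (simp add: complex_eq_iff)
    then show ?thesis by (simp add: add scaleR)
  qed
  then show ?case
    using trigpoly.add[OF trigpoly.cos[of "f 1" 1] trigpoly.sin[of "f \<i>" 1]] by simp
qed (auto intro: trigpoly_const trigpoly.add trigpoly_mult)

section \<open>Uniform approximation of continuous loops\<close>

lemma continuous_on_trigpoly: "trigpoly t \<Longrightarrow> continuous_on S t"
  by (induction rule: trigpoly.induct) (auto intro!: continuous_intros)

text \<open>As \<open>g 0 = g 1\<close>, the function descends to a continuous one on the unit
  circle, where Stone-Weierstrass applies; the approximating polynomial is pulled back along
  \<open>cis\<close>.\<close>

lemma trigpoly_uniformly_dense:
  fixes g :: "real \<Rightarrow> real"
  assumes "continuous_on {0..1} g" "g 0 = g 1" "0 < e"
  obtains t where "trigpoly t" "\<And>x. x \<in> {0..1} \<Longrightarrow> \<bar>g x - t x\<bar> < e"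
proof -
  define G where "G = g \<circ> (\<lambda>z. Arg2pi z / (2 * pi))"
  \<comment> \<open>The constant homotopy of the loop \<open>g\<close> is used only to obtain the continuity of \<open>G\<close> at \<open>1\<close>.\<close>
  have "homotopic_loops UNIV g g"
    using assms by (simp add: homotopic_loops_refl path_def pathstart_def pathfinish_def)
  then have "continuous_on (sphere 0 1) G"
    unfolding G_def
    using homotopic_loops_imp_homotopic_circlemaps homotopic_with_imp_continuous by blast
  then obtain p where p: "real_polynomial_function p" "\<And>z. z \<in> sphere 0 1 \<Longrightarrow> \<bar>G z - p z\<bar> < e"
    using Stone_Weierstrass_real_polynomial_function[of "sphere 0 1" G e] assms(3) by auto
  have "G (cis (2 * pi * x)) = g x" if "x \<in> {0..1}" for x
  \<comment> \<open>\<open>Arg2pi\<close> has values below \<open>2 * pi\<close>, so the endpoint 1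
    is sent to 0 and \<open>g 0 = g 1\<close> is used.\<close>
  proof (cases "x = 1")
    case True
    then show ?thesis using assms(2) Arg2pi_of_real[of 1] by (simp add: G_def)
  next
    case False
    then have "Arg2pi (cis (2 * pi * x)) = 2 * pi * x"
      using that by (intro Arg2pi_unique[of 1]) (auto simp: cis_conv_exp)
    then show ?thesis by (simp add: G_def)
  qed
  then have "\<bar>g x - p (cis (2 * pi * x))\<bar> < e" if "x \<in> {0..1}" for x
    using p(2)[of "cis (2 * pi * x)"] that by simp
  with trigpoly_of_real_polynomial_function[OF p(1)] show thesis by (rule that)
qed

section \<open>Mean-square closure of the trigonometric polynomials\<close>

lemma L2_01_diff:
  assumes "f \<in> L2_01" "g \<in> L2_01"
  shows "(\<lambda>x. f x - g x) \<in> L2_01"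
proof -
  have [measurable]: "f \<in> borel_measurable (lebesgue_on {0..1})" "g \<in> borel_measurable (lebesgue_on {0..1})"
    using assms by (auto simp: L2_01_def)
  have "integrable (lebesgue_on {0..1}) (\<lambda>x. (f x - g x)\<^sup>2)"
  proof (rule Bochner_Integration.integrable_bound)
    show "integrable (lebesgue_on {0..1}) (\<lambda>x. 2 * (f x)\<^sup>2 + 2 * (g x)\<^sup>2)"
      using assms by (auto simp: L2_01_def)
    show "AE x in lebesgue_on {0..1}. norm ((f x - g x)\<^sup>2) \<le> norm (2 * (f x)\<^sup>2 + 2 * (g x)\<^sup>2)"
    proof (rule AE_I2)
      fix x
      \<comment> \<open>The two sides differ by the square of \<open>f x + g x\<close>.\<close>
      have "(f x - g x)\<^sup>2 \<le> 2 * (f x)\<^sup>2 + 2 * (g x)\<^sup>2"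
        using zero_le_power2[of "f x + g x"] by (simp add: power2_sum power2_diff)
      then show "norm ((f x - g x)\<^sup>2) \<le> norm (2 * (f x)\<^sup>2 + 2 * (g x)\<^sup>2)" by simp
    qed
  qed measurable
  then show ?thesis
    by (simp add: L2_01_def)
qed

text \<open>A triangle inequality for squared distances; the factor 2 is the price of avoiding
  square roots.\<close>

lemma inner01_diff_self_triangle:
  assumes "f \<in> L2_01" "g \<in> L2_01" "h \<in> L2_01"
  shows "inner01 (\<lambda>x. f x - h x) (\<lambda>x. f x - h x)
    \<le> 2 * inner01 (\<lambda>x. f x - g x) (\<lambda>x. f x - g x) + 2 * inner01 (\<lambda>x. g x - h x) (\<lambda>x. g x - h x)"
proof -
  let ?M = "lebesgue_on {0..1::real}"
  have I: "integrable ?M (\<lambda>x. (u x - v x)\<^sup>2)" if "u \<in> L2_01" "v \<in> L2_01" for u v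
    using L2_01_diff[OF that] by (simp add: L2_01_def)
  have "(\<integral>x. (f x - h x)\<^sup>2 \<partial>?M) \<le> (\<integral>x. 2 * (f x - g x)\<^sup>2 + 2 * (g x - h x)\<^sup>2 \<partial>?M)"
  proof (rule integral_mono)
    fix x
    show "(f x - h x)\<^sup>2 \<le> 2 * (f x - g x)\<^sup>2 + 2 * (g x - h x)\<^sup>2"
      using zero_le_power2[of "(f x - g x) - (g x - h x)"] by (simp add: power2_eq_square algebra_simps)
  qed (use I assms in auto)
  also have "\<dots> = 2 * (\<integral>x. (f x - g x)\<^sup>2 \<partial>?M) + 2 * (\<integral>x. (g x - h x)\<^sup>2 \<partial>?M)"
    using I assms by simp
  finally show ?thesis by (simp add: inner01_def power2_eq_square)
qed

definition L2_closure_trigpoly :: "(real \<Rightarrow> real) set" where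
  "L2_closure_trigpoly = {h \<in> L2_01. \<forall>\<epsilon>>0. \<exists>t. trigpoly t \<and> inner01 (\<lambda>x. h x - t x) (\<lambda>x. h x - t x) < \<epsilon>}"

text \<open>Allows passage from loops to bounded functions and then to all of \<open>L2_01\<close>.
  Two squared errors below \<open>\<epsilon> / 4\<close> suffice because each is doubled.\<close>

lemma L2_closure_trigpoly_closed:
  assumes "h \<in> L2_01" "\<And>n. g n \<in> L2_closure_trigpoly"
    and "(\<lambda>n::nat. inner01 (\<lambda>x. h x - g n x) (\<lambda>x. h x - g n x)) \<longlonglongrightarrow> 0"
  shows "h \<in> L2_closure_trigpoly"
  unfolding L2_closure_trigpoly_def
proof (intro CollectI conjI allI impI)
  fix \<epsilon> :: real
  assume \<epsilon>: "\<epsilon> > 0"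
  then have "eventually (\<lambda>n. inner01 (\<lambda>x. h x - g n x) (\<lambda>x. h x - g n x) < \<epsilon> / 4) sequentially"
    using order_tendstoD(2)[OF assms(3), of "\<epsilon> / 4"] by simp
  then obtain n where n: "inner01 (\<lambda>x. h x - g n x) (\<lambda>x. h x - g n x) < \<epsilon> / 4"
    using eventually_sequentially by auto
  have "\<forall>\<epsilon>>0. \<exists>t. trigpoly t \<and> inner01 (\<lambda>x. g n x - t x) (\<lambda>x. g n x - t x) < \<epsilon>"
    using assms(2)[of n] by (simp add: L2_closure_trigpoly_def)
  from this[rule_format, of "\<epsilon> / 4"] \<epsilon>
  obtain t where t: "trigpoly t" "inner01 (\<lambda>x. g n x - t x) (\<lambda>x. g n x - t x) < \<epsilon> / 4"
    by auto
  have "g n \<in> L2_01" "t \<in> L2_01"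
    using assms(2)[of n] continuous_L2_01[OF continuous_on_trigpoly[OF t(1)]]
    by (auto simp: L2_closure_trigpoly_def)
  from inner01_diff_self_triangle[OF assms(1) this] n t
  show "\<exists>t. trigpoly t \<and> inner01 (\<lambda>x. h x - t x) (\<lambda>x. h x - t x) < \<epsilon>"
    by (intro exI[of _ t]) auto
qed (fact assms(1))

lemma continuous_loop_in_L2_closure_trigpoly:
  assumes "continuous_on {0..1} g" "g 0 = g 1"
  shows "g \<in> L2_closure_trigpoly"
  unfolding L2_closure_trigpoly_def
proof (intro CollectI conjI allI impI)
  fix \<epsilon> :: real
  assume \<epsilon>: "\<epsilon> > 0"
  \<comment> \<open>The interval has length 1, so this uniform error gives a squared distance of at
    most \<open>\<epsilon> / 2\<close>.\<close>
  obtain t where t: "trigpoly t" "\<And>x. x \<in> {0..1} \<Longrightarrow> \<bar>g x - t x\<bar> < sqrt (\<epsilon> / 2)"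
    using trigpoly_uniformly_dense[OF assms, of "sqrt (\<epsilon> / 2)"] \<epsilon> by auto
  have "inner01 (\<lambda>x. g x - t x) (\<lambda>x. g x - t x) \<le> (\<integral>x. \<epsilon> / 2 \<partial>lebesgue_on {0..1::real})"
    unfolding inner01_def
  proof (rule integral_mono)
    fix x :: real
    assume "x \<in> space (lebesgue_on {0..1})"
    then have "\<bar>g x - t x\<bar>\<^sup>2 \<le> (sqrt (\<epsilon> / 2))\<^sup>2"
      using t(2)[of x] by (intro power_mono) auto
    then show "(g x - t x) * (g x - t x) \<le> \<epsilon> / 2"
      using \<epsilon> by (simp add: power2_eq_square)
  qed (auto intro!: continuous_imp_integrable_real continuous_intros assms continuous_on_trigpoly[OF t(1)])
  also have "\<dots> < \<epsilon>" using \<epsilon> by (simp add: measure_restrict_space)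
  finally show "\<exists>t. trigpoly t \<and> inner01 (\<lambda>x. g x - t x) (\<lambda>x. g x - t x) < \<epsilon>"
    using t(1) by blast
qed (rule continuous_L2_01[OF assms(1)])

text \<open>Dominated convergence for the squared differences, with majorant
  \<open>(w x)\<^sup>2\<close>.\<close>

lemma inner01_dominated_convergence:
  assumes "h \<in> borel_measurable (lebesgue_on {0..1})" "\<And>n. g n \<in> borel_measurable (lebesgue_on {0..1})"
    and "integrable (lebesgue_on {0..1}) (\<lambda>x. (w x)\<^sup>2)"
    and "AE x in lebesgue_on {0..1}. (\<lambda>n. g n x) \<longlonglongrightarrow> h x"
    and "\<And>n x. x \<in> {0..1} \<Longrightarrow> \<bar>h x - g n x\<bar> \<le> \<bar>w x\<bar>"
  shows "(\<lambda>n::nat. inner01 (\<lambda>x. h x - g n x) (\<lambda>x. h x - g n x)) \<longlonglongrightarrow> 0"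
proof -
  have "(\<lambda>n. \<integral>x. (h x - g n x)\<^sup>2 \<partial>lebesgue_on {0..1}) \<longlonglongrightarrow> (\<integral>x. 0 \<partial>lebesgue_on {0..1::real})"
  proof (rule integral_dominated_convergence[where w = "\<lambda>x. (w x)\<^sup>2"])
    show "AE x in lebesgue_on {0..1}. (\<lambda>n. (h x - g n x)\<^sup>2) \<longlonglongrightarrow> 0"
      using assms(4) by eventually_elim (auto intro!: tendsto_eq_intros)
    show "AE x in lebesgue_on {0..1}. norm ((h x - g n x)\<^sup>2) \<le> (w x)\<^sup>2" for n
    proof (rule AE_I2)
      fix x :: real
      assume "x \<in> space (lebesgue_on {0..1})"
      then have "\<bar>h x - g n x\<bar>\<^sup>2 \<le> \<bar>w x\<bar>\<^sup>2"
        using assms(5)[of x n] by (intro power_mono) auto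
      then show "norm ((h x - g n x)\<^sup>2) \<le> (w x)\<^sup>2" by simp
    qed
  qed (use assms in measurable)
  then show ?thesis by (simp add: inner01_def power2_eq_square)
qed

section \<open>From loops to square-integrable functions by truncation\<close>

definition clamp_abs :: "real \<Rightarrow> real \<Rightarrow> real" where
  "clamp_abs B y = max (- B) (min B y)"

lemma clamp_abs_le: "0 \<le> B \<Longrightarrow> \<bar>clamp_abs B y\<bar> \<le> B"
  by (auto simp: clamp_abs_def)

text \<open>A measurable function is an almost everywhere limit of continuous ones; clamping these
  at \<open>B\<close> supplies the domination and leaves the limit \<open>h\<close>
  unchanged.\<close>

lemma bounded_in_L2_closure_trigpoly:
  assumes h: "h \<in> borel_measurable (lebesgue_on {0..1})" and B: "\<And>x. x \<in> {0..1} \<Longrightarrow> \<bar>h x\<bar> \<le> B"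
  shows "h \<in> L2_closure_trigpoly"
proof -
  have "B \<ge> 0" using B[of 0] by simp
  obtain N g where N: "negligible N" and g: "\<And>n. continuous_on UNIV (g n)"
    and lim: "\<And>x. x \<notin> N \<Longrightarrow> (\<lambda>n::nat. g n x) \<longlonglongrightarrow> (if x \<in> {0..1} then h x else 0)"
    using h measurable_on_iff_borel_measurable[of "{0..1}" h] unfolding measurable_on_def by auto
  \<comment> \<open>The cutoff \<open>\<phi>\<close> vanishes at both endpoints, which makes the approximants loops.\<close>
  define \<phi> where "\<phi> = (\<lambda>(n::nat) x::real. min 1 (real n * (x * (1 - x))))"
  define f where "f = (\<lambda>n x. \<phi> n x * clamp_abs B (g n x))"
  have contf: "continuous_on {0..1} (f n)" for n
    unfolding f_def \<phi>_def clamp_abs_def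
    by (intro continuous_intros continuous_on_subset[OF g]) auto
  have bd: "\<bar>f n x\<bar> \<le> B" if "x \<in> {0..1}" for n x
  proof -
    have "\<bar>\<phi> n x\<bar> \<le> 1" using that by (auto simp: \<phi>_def abs_le_iff min_le_iff_disj)
    then have "\<bar>\<phi> n x\<bar> * \<bar>clamp_abs B (g n x)\<bar> \<le> 1 * B"
      using clamp_abs_le[OF \<open>B \<ge> 0\<close>] by (intro mult_mono) auto
    then show ?thesis by (simp add: f_def abs_mult)
  qed
  \<comment> \<open>The endpoints are discarded as well, because the cutoff forces the value 0
    there; at every interior point it is eventually 1.\<close>
  have "AE x in lebesgue_on {0..1}. x \<notin> N \<union> {0, 1}"
  proof -
    have "negligible (N \<union> {0, 1})" using N by (simp add: negligible_Un)
    then have "AE x in lebesgue. x \<notin> N \<union> {0, 1}"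
      using negligible_iff_null_sets AE_not_in by blast
    then show ?thesis by (subst AE_restrict_space_iff) auto
  qed
  then have limf: "AE x in lebesgue_on {0..1}. (\<lambda>n. f n x) \<longlonglongrightarrow> h x"
  proof (rule lebesgue_on_mono)
    fix x :: real
    assume x: "x \<notin> N \<union> {0, 1}" "x \<in> {0..1}"
    then have "x * (1 - x) > 0" by (intro mult_pos_pos) auto
    then obtain k where k: "real k * (x * (1 - x)) > 1"
      using reals_Archimedean3 by blast
    have "\<phi> n x = 1" if "n \<ge> k" for n
    proof -
      have "real k * (x * (1 - x)) \<le> real n * (x * (1 - x))"
        using that \<open>x * (1 - x) > 0\<close> by (intro mult_right_mono) auto
      then show ?thesis using k by (simp add: \<phi>_def)
    qed
    then have ev: "eventually (\<lambda>n. clamp_abs B (g n x) = f n x) sequentially"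
      unfolding eventually_sequentially by (intro exI[of _ k]) (simp add: f_def)
    have "(\<lambda>n. clamp_abs B (g n x)) \<longlonglongrightarrow> clamp_abs B (h x)"
      unfolding clamp_abs_def using lim[of x] x by (intro tendsto_intros) auto
    moreover have "clamp_abs B (h x) = h x"
      using B[OF x(2)] by (auto simp: clamp_abs_def)
    ultimately show "(\<lambda>n. f n x) \<longlonglongrightarrow> h x"
      using Lim_transform_eventually[OF _ ev] by simp
  qed
  show ?thesis
  proof (rule L2_closure_trigpoly_closed)
    show "f n \<in> L2_closure_trigpoly" for n
      by (rule continuous_loop_in_L2_closure_trigpoly[OF contf]) (simp add: f_def \<phi>_def)
    show "(\<lambda>n. inner01 (\<lambda>x. h x - f n x) (\<lambda>x. h x - f n x)) \<longlonglongrightarrow> 0"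
    proof (rule inner01_dominated_convergence[OF h _ _ limf])
      show "f n \<in> borel_measurable (lebesgue_on {0..1})" for n
        by (rule continuous_imp_measurable_on_sets_lebesgue[OF contf]) simp
      show "\<bar>h x - f n x\<bar> \<le> \<bar>2 * B\<bar>" if "x \<in> {0..1}" for n x
        using bd[OF that, of n] B[OF that] by linarith
    qed simp
    have "integrable (lebesgue_on {0..1}) (\<lambda>x. (h x)\<^sup>2)"
    proof (rule Bochner_Integration.integrable_bound)
      show "integrable (lebesgue_on {0..1::real}) (\<lambda>x. B\<^sup>2)" by simp
      show "AE x in lebesgue_on {0..1}. norm ((h x)\<^sup>2) \<le> norm (B\<^sup>2)"
        using B by (intro AE_I2) (auto intro: power2_le_iff_abs_le[THEN iffD2, OF \<open>B \<ge> 0\<close>])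
    qed (use h in measurable)
    then show "h \<in> L2_01" using h by (simp add: L2_01_def)
  qed
qed

text \<open>Truncation at height \<open>n\<close> is eventually exact at each point, and the error
  never exceeds \<open>\<bar>h x\<bar>\<close>, whose square is integrable.\<close>

lemma L2_01_subset_L2_closure_trigpoly: "L2_01 \<subseteq> L2_closure_trigpoly"
proof
  fix h
  assume "h \<in> L2_01"
  then have h: "h \<in> borel_measurable (lebesgue_on {0..1})" "integrable (lebesgue_on {0..1}) (\<lambda>x. (h x)\<^sup>2)"
    by (auto simp: L2_01_def)
  have meas: "(\<lambda>x. clamp_abs (real n) (h x)) \<in> borel_measurable (lebesgue_on {0..1})" for n
    unfolding clamp_abs_def using h(1) by measurable
  show "h \<in> L2_closure_trigpoly"
  proof (rule L2_closure_trigpoly_closed[OF \<open>h \<in> L2_01\<close>])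
    show "(\<lambda>x. clamp_abs (real n) (h x)) \<in> L2_closure_trigpoly" for n
      by (rule bounded_in_L2_closure_trigpoly[OF meas clamp_abs_le]) simp
    show "(\<lambda>n. inner01 (\<lambda>x. h x - clamp_abs (real n) (h x)) (\<lambda>x. h x - clamp_abs (real n) (h x))) \<longlonglongrightarrow> 0"
    proof (rule inner01_dominated_convergence[OF h(1) meas h(2)])
      show "AE x in lebesgue_on {0..1}. (\<lambda>n. clamp_abs (real n) (h x)) \<longlonglongrightarrow> h x"
      proof (rule AE_I2, rule tendsto_eventually)
        fix x
        obtain k where "\<bar>h x\<bar> \<le> real k" using real_arch_simple by blast
        then show "eventually (\<lambda>n. clamp_abs (real n) (h x) = h x) sequentially"
          unfolding eventually_sequentially by (intro exI[of _ k]) (auto simp: clamp_abs_def)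
      qed
    qed (auto simp: clamp_abs_def)
  qed
qed

section \<open>Trigonometric polynomials as finite combinations\<close>

text \<open>Shaped after the approximants in the completeness clause, with equality of functions
  everywhere.\<close>

definition finspan :: "'i set \<Rightarrow> ('i \<Rightarrow> real \<Rightarrow> real) \<Rightarrow> (real \<Rightarrow> real) set" where
  "finspan I e = {f. \<exists>F c. finite F \<and> F \<subseteq> I \<and> f = (\<lambda>x. \<Sum>i\<in>F. c i * e i x)}"

lemma finspan_base: "i \<in> I \<Longrightarrow> e i \<in> finspan I e"
  unfolding finspan_def by (intro CollectI exI[of _ "{i}"] exI[of _ "\<lambda>_. 1"]) auto

lemma finspan_scale:
  assumes "f \<in> finspan I e"
  shows "(\<lambda>x. r * f x) \<in> finspan I e"
proof -
  obtain F c where "finite F" "F \<subseteq> I" "f = (\<lambda>x. \<Sum>i\<in>F. c i * e i x)"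
    using assms unfolding finspan_def by auto
  then show ?thesis unfolding finspan_def
    by (intro CollectI exI[of _ F] exI[of _ "\<lambda>i. r * c i"]) (auto simp: sum_distrib_left mult.assoc)
qed

lemma finspan_add:
  assumes "f \<in> finspan I e" "g \<in> finspan I e"
  shows "(\<lambda>x. f x + g x) \<in> finspan I e"
proof -
  obtain F c where F: "finite F" "F \<subseteq> I" "f = (\<lambda>x. \<Sum>i\<in>F. c i * e i x)"
    using assms(1) unfolding finspan_def by auto
  obtain G d where G: "finite G" "G \<subseteq> I" "g = (\<lambda>x. \<Sum>i\<in>G. d i * e i x)"
    using assms(2) unfolding finspan_def by auto
  \<comment> \<open>Both coefficient families are extended by zero to the union, since
    \<open>F\<close> and \<open>G\<close> may overlap.\<close>
  let ?c = "\<lambda>i. (if i \<in> F then c i else 0) + (if i \<in> G then d i else 0)"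
  have "(\<Sum>i\<in>F. c i * e i x) = (\<Sum>i\<in>F \<union> G. (if i \<in> F then c i else 0) * e i x)" for x
    using F(1) G(1) by (intro sum.mono_neutral_cong_left) auto
  moreover have "(\<Sum>i\<in>G. d i * e i x) = (\<Sum>i\<in>F \<union> G. (if i \<in> G then d i else 0) * e i x)" for x
    using F(1) G(1) by (intro sum.mono_neutral_cong_left) auto
  ultimately have "(\<lambda>x. f x + g x) = (\<lambda>x. \<Sum>i\<in>F \<union> G. ?c i * e i x)"
    using F(3) G(3) by (simp add: distrib_right sum.distrib)
  then show ?thesis unfolding finspan_def
    using F(1,2) G(1,2) by (intro CollectI exI[of _ "F \<union> G"] exI[of _ ?c]) auto
qed

context bounded_family
begin

text \<open>Solving the even case of \<open>til\<close> for \<open>hat a u k\<close> reduces it to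
  index \<open>k div 2\<close>; the descent ends at an odd index, where hat and tilde agree.\<close>

lemma hat_in_finspan:
  assumes a: "\<bar>a\<bar> < 1" and til: "\<And>k. 0 < k \<Longrightarrow> til a u k \<in> finspan I e" and "0 < k"
  shows "hat a u k \<in> finspan I e"
  using \<open>0 < k\<close>
proof (induction k rule: less_induct)
  case (less k)
  show ?case
  proof (cases "odd k")
    case True
    then have "til a u k = hat a u k" by (simp add: til_def fun_eq_iff)
    then show ?thesis using til[OF less.prems] by simp
  next
    case False
    have "sqrt (1 - a\<^sup>2) \<noteq> 0"
      using a by (simp add: abs_square_eq_1)
    then have "hat a u k = (\<lambda>x. sqrt (1 - a\<^sup>2) * til a u k x + a * hat a u (k div 2) x)"
      using False by (simp add: til_def fun_eq_iff)
    moreover have "hat a u (k div 2) \<in> finspan I e"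
      using False less.prems by (intro less.IH) auto
    ultimately show ?thesis
      using til[OF less.prems] by (simp only: finspan_add finspan_scale)
  qed
qed

text \<open>\<open>hat_unfold\<close> is solved for \<open>u k\<close>, leaving the hat functions of
  indices \<open>k\<close> and \<open>2 * k\<close>.\<close>

lemma in_finspan:
  assumes a: "\<bar>a\<bar> < 1" and "\<And>k. 0 < k \<Longrightarrow> til a u k \<in> finspan I e" and "0 < k"
  shows "u k \<in> finspan I e"
proof -
  have "sqrt (1 - a\<^sup>2) \<noteq> 0"
    using a by (simp add: abs_square_eq_1)
  then have "u k = (\<lambda>x. (1 / sqrt (1 - a\<^sup>2)) * hat a u k x + (- a / sqrt (1 - a\<^sup>2)) * hat a u (2 * k) x)"
    using hat_unfold[OF a, of k] by (simp add: fun_eq_iff field_simps)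
  moreover have "hat a u k \<in> finspan I e" "hat a u (2 * k) \<in> finspan I e"
    using hat_in_finspan[OF assms(1,2)] assms(3) by simp_all
  ultimately show ?thesis by (simp only: finspan_add finspan_scale)
qed

end

lemma trigpoly_in_finspan:
  assumes "\<bar>a\<bar> < 1" "trigpoly t"
  shows "t \<in> finspan tidx_set (tbasis a)"
  using assms(2)
proof induction
  let ?S = "finspan tidx_set (tbasis a)"
  have one: "(\<lambda>x. 1) \<in> ?S"
    using finspan_base[of One tidx_set "tbasis a"] by (simp add: tidx_set_def)
  have ck: "ck k \<in> ?S" if "0 < k" for k
    using finspan_base[of "Cos _" tidx_set "tbasis a"] that
    by (intro ck.in_finspan[OF assms(1)]) (auto simp: tidx_set_def ctil_eq_til)
  have sk: "sk k \<in> ?S" if "0 < k" for k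
    using finspan_base[of "Sin _" tidx_set "tbasis a"] that
    by (intro sk.in_finspan[OF assms(1)]) (auto simp: tidx_set_def stil_eq_til)
  {
    case (cos r k)
    have "(\<lambda>x. r * cos (2 * pi * real k * x)) = (\<lambda>x. r / sqrt 2 * ck k x)"
      by (simp add: ck_def mult_ac)
    \<comment> \<open>Frequency zero is separate because \<open>tidx_set\<close> has no
      \<open>Cos 0\<close>: the cosine becomes the constant \<open>r\<close>, and the sine below
      becomes 0 times the constant 1.\<close>
    then show ?case
      using finspan_scale[OF ck, of k "r / sqrt 2"] finspan_scale[OF one, of r] by (cases "k = 0") auto
  next
    case (sin r k)
    have "(\<lambda>x. r * sin (2 * pi * real k * x)) = (\<lambda>x. r / sqrt 2 * sk k x)"
      by (simp add: sk_def mult_ac)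
    then show ?case
      using finspan_scale[OF sk, of k "r / sqrt 2"] finspan_scale[OF one, of 0] by (cases "k = 0") auto
  next
    case (add f g)
    then show ?case by (intro finspan_add)
  }
qed

section \<open>Orthonormality and completeness of the tilde system\<close>

interpretation ck_ck: biorthogonal_families ck "sqrt 2" ck "sqrt 2" 1
  by standard (rule inner01_ck_ck)

interpretation sk_sk: biorthogonal_families sk "sqrt 2" sk "sqrt 2" 1
  by standard (rule inner01_sk_sk)

interpretation ck_sk: biorthogonal_families ck "sqrt 2" sk "sqrt 2" 0
  by standard (simp add: inner01_ck_sk)

theorem theorem5p2:
  fixes a :: real
  assumes "\<bar>a\<bar> < 1"
  shows "(\<forall>i x. 0 < i \<and> even i \<longrightarrow>
            (chat a i x - a * chat a (i div 2) x) / sqrt (1 - a^2)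
              = sqrt (1 - a^2) * chat a i x - a * ck (i div 2) x) \<and>
         (\<forall>i x. 0 < i \<and> even i \<longrightarrow>
            (shat a i x - a * shat a (i div 2) x) / sqrt (1 - a^2)
              = sqrt (1 - a^2) * shat a i x - a * sk (i div 2) x) \<and>
         complete_orthonormal_basis_L2 tidx_set (tbasis a)"
proof (intro conjI)
  show "complete_orthonormal_basis_L2 tidx_set (tbasis a)"
    unfolding complete_orthonormal_basis_L2_def
  proof (intro conjI ballI allI impI)
    fix i assume "i \<in> tidx_set"
    then show "tbasis a i \<in> L2_01"
      using assms by (intro continuous_L2_01, cases i)
        (auto simp: ctil_eq_til stil_eq_til intro: ck.continuous_on_til sk.continuous_on_til)
  next
    fix i j assume "i \<in> tidx_set" "j \<in> tidx_set"
    moreover have "inner01 (\<lambda>x. 1) (\<lambda>x. 1) = 1"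
      by (simp add: inner01_def measure_restrict_space)
    ultimately show "inner01 (tbasis a i) (tbasis a j) = (if i = j then 1 else 0)"
      using ck.inner01_til_1[OF assms inner01_ck_1] sk.inner01_til_1[OF assms inner01_sk_1]
        ck_ck.inner01_til_til[OF assms] sk_sk.inner01_til_til[OF assms] ck_sk.inner01_til_til[OF assms]
      \<comment> \<open>Mixed pairs are brought by symmetry to the order in which their
        orthogonality is known.\<close>
      by (cases i; cases j)
        (auto simp: tidx_set_def ctil_eq_til stil_eq_til inner01_commute[of "\<lambda>x. 1" "til a _ _"]
          inner01_commute[of "til a sk _" "til a ck _"])
  next
    fix h and \<epsilon> :: real
    assume "h \<in> L2_01" "\<epsilon> > 0"
    then obtain t where t: "trigpoly t" "inner01 (\<lambda>x. h x - t x) (\<lambda>x. h x - t x) < \<epsilon>"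
      using L2_01_subset_L2_closure_trigpoly unfolding L2_closure_trigpoly_def by auto
    then show "\<exists>F c. finite F \<and> F \<subseteq> tidx_set \<and>
        inner01 (\<lambda>x. h x - (\<Sum>i\<in>F. c i * tbasis a i x)) (\<lambda>x. h x - (\<Sum>i\<in>F. c i * tbasis a i x)) < \<epsilon>"
      using trigpoly_in_finspan[OF assms t(1)] unfolding finspan_def by auto
  qed
qed (use ck.even_til_alternative[OF assms] sk.even_til_alternative[OF assms]
    in \<open>unfold chat_eq_hat shat_eq_hat, blast+\<close>)

end
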